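(* Let $K$ be a real-closed, non-Archimedean-ordered valued field with valuation $v$ and residue field $k$ (which is also assumed real-closed). Let $P(x)=\sum_{i=0}^n c_ix^i\in K[x]$ with $c_n\neq0$. Suppose the Newton polygon of $P$ has edges $\sigma_1,\dots,\sigma_r$ with slopes $\lambda_1,\dots,\lambda_r$, and let $P_j=\sum\{\operatorname{sign}(c_i)x^i : (i,v(c_i))\in\sigma_j\}$. Factor $P=c_nQ(x)\prod_{i=1}^l(x-\alpha_i)$ where $\alpha_1,\dots,\alpha_l\in K$ are the roots of $P$ in $K$ (listed with multiplicity) and $Q\in K[x]$ has no roots in $K$. Then (1) for every $i$ there exists $j$ with $v(\alpha_i)=-\lambda_j$; (2) for every $j$, $\Delta(P_j)\ge\#\{i: v(\alpha_i)=-\lambda_j,\ \alpha_i>0\}$, and the two quantities differ by an even number.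
   Context: A valued field is a field $K$ with a map $v:K\to\mathbb{R}\cup\{\infty\}$ such that $v(0)=\infty$, $v$ restricted to $K^\times$ is a group homomorphism to $(\mathbb{R},+)$, and $v(x+y)\ge\min\{v(x),v(y)\}$. Its valuation ring is $\mathcal{O}_K=\{v\ge0\}$, with maximal ideal $\{v>0\}$ and residue field $k$. A real-closed field has a unique ordering ($x\ge0$ iff $x$ is a square), giving $\operatorname{sign}:K\to\{-1,0,1\}$. "Non-Archimedean-ordered" means $\mathcal{O}_K$ is convex for this ordering (i.e., if $x\in K$ satisfies $-a\le x\le a$ for some $a\in\mathcal{O}_K$ then $x\in\mathcal{O}_K$); the residue field is then real, and it is assumed real-closed. The Newton polygon of $P$ is the lower convex hull of the points $(i,v(c_i))$, $i=0,\dots,n$ (with $v(c_i)<\infty$); its edges are its bounded edges. For a polynomial over $\{-1,0,1\}$ or over an ordered field, $\Delta$ is the number of sign changes in its sequence of coefficients, ignoring zeros.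
   Formalization: Part (1) is stated for nonzero roots only: a root equal to 0 has valuation ∞, which is never minus the slope of a bounded edge (for example P = x has no edges), so (1) fails for zero roots. *)

theory Defs
  imports "HOL-Computational_Algebra.Polynomial" "HOL-Library.Extended_Real"
begin

text \<open>Real-closed ordered field (the ordering of a real-closed field is unique,
  so it is the type-class ordering): nonnegatives are squares and every
  odd-degree polynomial has a root.\<close>
definition real_closed :: "'a::linordered_field itself \<Rightarrow> bool" where
  "real_closed _ \<longleftrightarrow>
     (\<forall>x::'a. x \<ge> 0 \<longrightarrow> (\<exists>y. x = y * y)) \<and>
     (\<forall>p::'a poly. odd (degree p) \<longrightarrow> (\<exists>x. poly p x = 0))"

definition valuation :: "('a::field \<Rightarrow> ereal) \<Rightarrow> bool" where
  "valuation v \<longleftrightarrow>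
     v 0 = \<infinity> \<and>
     (\<forall>x. x \<noteq> 0 \<longrightarrow> (\<exists>r::real. v x = ereal r)) \<and>
     (\<forall>x y. x \<noteq> 0 \<longrightarrow> y \<noteq> 0 \<longrightarrow> v (x * y) = v x + v y) \<and>
     (\<forall>x y. v (x + y) \<ge> min (v x) (v y))"

definition non_archimedean_ordered :: "('a::linordered_field \<Rightarrow> ereal) \<Rightarrow> bool" where
  "non_archimedean_ordered v \<longleftrightarrow>
     (\<forall>x a. v a \<ge> 0 \<longrightarrow> -a \<le> x \<longrightarrow> x \<le> a \<longrightarrow> v x \<ge> 0)"

text \<open>The residue field O/m (with its induced ordering) is real closed:
  every positive residue class is a square, and every odd-degree polynomial
  over the residue field has a root.  Residue classes are represented by
  elements of O, polynomials over k by polynomials over O whose leading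
  coefficient is a unit; "equal in k" means the difference lies in m.\<close>
definition residue_real_closed :: "('a::linordered_field \<Rightarrow> ereal) \<Rightarrow> bool" where
  "residue_real_closed v \<longleftrightarrow>
     (\<forall>a. v a = 0 \<longrightarrow> a > 0 \<longrightarrow> (\<exists>b. v b \<ge> 0 \<and> v (b * b - a) > 0)) \<and>
     (\<forall>p. (\<forall>i. v (coeff p i) \<ge> 0) \<longrightarrow> v (lead_coeff p) = 0 \<longrightarrow> odd (degree p) \<longrightarrow>
          (\<exists>b. v b \<ge> 0 \<and> v (poly p b) > 0))"

definition npt :: "('a::field \<Rightarrow> ereal) \<Rightarrow> 'a poly \<Rightarrow> nat \<Rightarrow> real" where
  "npt v p i = real_of_ereal (v (coeff p i))"

definition newton_slope :: "('a::field \<Rightarrow> ereal) \<Rightarrow> 'a poly \<Rightarrow> nat \<Rightarrow> nat \<Rightarrow> real" where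
  "newton_slope v p a b = (npt v p b - npt v p a) / (real b - real a)"

definition on_line :: "('a::field \<Rightarrow> ereal) \<Rightarrow> 'a poly \<Rightarrow> nat \<Rightarrow> nat \<Rightarrow> nat \<Rightarrow> bool" where
  "on_line v p a b i \<longleftrightarrow>
     coeff p i \<noteq> 0 \<and> npt v p i = npt v p a + newton_slope v p a b * (real i - real a)"

text \<open>The segment from (a, v c_a) to (b, v c_b) is a (bounded) edge of the lower
  convex hull: all points lie on or above its line, and a, b are the extreme
  points on that line.\<close>
definition newton_edge :: "('a::field \<Rightarrow> ereal) \<Rightarrow> 'a poly \<Rightarrow> nat \<Rightarrow> nat \<Rightarrow> bool" where
  "newton_edge v p a b \<longleftrightarrow>
     a < b \<and> b \<le> degree p \<and> coeff p a \<noteq> 0 \<and> coeff p b \<noteq> 0 \<and>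
     (\<forall>i \<le> degree p. coeff p i \<noteq> 0 \<longrightarrow>
        npt v p i \<ge> npt v p a + newton_slope v p a b * (real i - real a)) \<and>
     (\<forall>i \<le> degree p. on_line v p a b i \<longrightarrow> a \<le> i \<and> i \<le> b)"

definition on_edge :: "('a::field \<Rightarrow> ereal) \<Rightarrow> 'a poly \<Rightarrow> nat \<Rightarrow> nat \<Rightarrow> nat \<Rightarrow> bool" where
  "on_edge v p a b i \<longleftrightarrow> a \<le> i \<and> i \<le> b \<and> on_line v p a b i"

definition edge_poly :: "('a::linordered_field \<Rightarrow> ereal) \<Rightarrow> 'a poly \<Rightarrow> nat \<Rightarrow> nat \<Rightarrow> 'a poly" where
  "edge_poly v p a b = (\<Sum>i\<in>{i. i \<le> degree p \<and> on_edge v p a b i}. monom (sgn (coeff p i)) i)"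

definition sign_changes_list :: "'a::linordered_idom list \<Rightarrow> nat" where
  "sign_changes_list xs =
     (let ys = filter (\<lambda>x. x \<noteq> 0) xs
      in length (filter (\<lambda>(x, y). x * y < 0) (zip ys (tl ys))))"

definition sign_changes :: "'a::linordered_idom poly \<Rightarrow> nat" where
  "sign_changes p = sign_changes_list (coeffs p)"

end

theory Submission
  imports Defs "HOL-Algebra.Algebraic_Closure_Type"
begin

text \<open>
  Fix a slope \<open>\<mu>\<close>.  The first and the last index at which a supporting line of slope \<open>\<mu>\<close> meets the
  Newton polygon are additive under multiplication, and the signs of the coefficients there are
  multiplicative.  A linear factor \<open>X - \<alpha>\<close> separates the two indices exactly if \<open>v \<alpha> = - \<mu>\<close>,
  which gives (1).  For (2), write \<open>P\<close> as the product of the \<open>m\<close> factors \<open>X - \<alpha>\<close> with \<open>\<alpha> > 0\<close>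
  and \<open>v \<alpha> = - \<mu>\<close> and of a rest.  Convexity of the valuation ring shows that a term of smaller
  valuation determines the sign of a sum, and that terms of equal sign do not cancel; so each of the
  \<open>m\<close> factors raises the number of sign changes by at least one, as in Descartes' rule.  The parity of
  this number is determined by the signs at the two extreme indices.  These agree for the rest, since
  a polynomial without roots is a product of constants and quadratics \<open>(X - a)\<^sup>2 + b\<^sup>2\<close>, and each of the
  \<open>m\<close> factors flips one of them.

  The factorization into quadratics is Laplace's argument by induction on the power of \<open>2\<close> in the degree,
  carried out in the algebraic closure.  Instead of the theorem on symmetric polynomials it uses Newton's
  identities: in characteristic zero the coefficients of a monic polynomial lie in a subfield if and
  only if all power sums of its roots do.
\<close>

hide_const (open) Polynomials.degree Polynomials.lead_coeff up_ring.coeff up_ring.monom module.smult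

section \<open>Factorization over real-closed fields\<close>

locale subfield_char_0 =
  fixes S :: "'b::field_char_0 set"
  assumes one [simp]: "1 \<in> S"
    and add [intro]: "x \<in> S \<Longrightarrow> y \<in> S \<Longrightarrow> x + y \<in> S"
    and uminus [intro]: "x \<in> S \<Longrightarrow> - x \<in> S"
    and mult [intro]: "x \<in> S \<Longrightarrow> y \<in> S \<Longrightarrow> x * y \<in> S"
    and inverse [intro]: "x \<in> S \<Longrightarrow> inverse x \<in> S"
begin

lemma zero [simp]: "0 \<in> S"
  using add[OF one uminus[OF one]] by simp

lemma diff [intro]: "x \<in> S \<Longrightarrow> y \<in> S \<Longrightarrow> x - y \<in> S"
  using add[of x "- y"] by auto

lemma divide [intro]: "x \<in> S \<Longrightarrow> y \<in> S \<Longrightarrow> x / y \<in> S"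
  unfolding divide_inverse by auto

lemma of_nat [simp]: "of_nat n \<in> S"
  by (induction n) auto

lemma numeral [simp]: "numeral n \<in> S"
  using of_nat[of "numeral n"] by (simp del: of_nat)

lemma sum [intro]: "(\<And>x. x \<in> A \<Longrightarrow> f x \<in> S) \<Longrightarrow> sum f A \<in> S"
  by (induction A rule: infinite_finite_induct) auto

end

section \<open>Newton's identities for the power sums of a list of roots\<close>

definition power_sum :: "'b::comm_semiring_1 list \<Rightarrow> nat \<Rightarrow> 'b" where
  "power_sum rs k = (\<Sum>r\<leftarrow>rs. r ^ k)"

definition root_poly :: "'b::comm_ring_1 list \<Rightarrow> 'b poly" where
  "root_poly rs = (\<Prod>r\<leftarrow>rs. [:- r, 1:])"

lemma root_poly_simps [simp]:
  "root_poly [] = 1" "root_poly (r # rs) = [:- r, 1:] * root_poly rs"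
  by (simp_all add: root_poly_def)

lemma degree_root_poly [simp]: "degree (root_poly rs :: 'b::idom poly) = length rs"
  and root_poly_nonzero [simp]: "root_poly rs \<noteq> (0 :: 'b::idom poly)"
proof (induction rs)
  case (Cons r rs)
  case 1
  show ?case using Cons by (simp add: degree_mult_eq del: mult_pCons_left)
  case 2
  show ?case using Cons by (simp del: mult_pCons_left)
qed simp_all

lemma lead_coeff_root_poly [simp]: "lead_coeff (root_poly rs :: 'b::idom poly) = 1"
  by (induction rs) (simp_all add: lead_coeff_mult del: degree_root_poly mult_pCons_left)

lemma poly_root_poly_eq_0_iff: "poly (root_poly rs) x = 0 \<longleftrightarrow> x \<in> set rs"
  for x :: "'b::idom"
  by (induction rs) auto

text \<open>Logarithmic derivative: \<open>F\<close> is the product of the factors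
  \<open>1 - r X\<close>, and \<open>F' / F\<close> is the sum of the series
  \<open>- r / (1 - r X)\<close>, whose coefficients are negated power sums. The induction over the
  factors proves this in product form, without division.\<close>

lemma fps_newton:
  fixes rs :: "'b::idom list"
  defines "F \<equiv> fps_of_poly (reflect_poly (root_poly rs))"
  shows "fps_deriv F = - F * Abs_fps (\<lambda>k. power_sum rs (Suc k))"
  unfolding F_def
proof (induction rs)
  case Nil
  show ?case by (simp add: power_sum_def fps_eq_iff)
next
  case (Cons r rs)
  define G where "G = fps_of_poly (reflect_poly (root_poly rs))"
  define L where "L = 1 - fps_const r * fps_X"
  define S where "S = Abs_fps (\<lambda>k. power_sum rs (Suc k))"
  define E where "E = Abs_fps (\<lambda>k. r ^ Suc k)"
  have split: "fps_of_poly (reflect_poly (root_poly (r # rs))) = L * G"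
  proof -
    have "reflect_poly [:- r, 1:] = [:1, - r:]"
      by (simp add: reflect_poly_pCons' monom_Suc monom_0)
    then show ?thesis
      unfolding root_poly_simps reflect_poly_mult fps_of_poly_mult G_def L_def
      by (simp add: fps_of_poly_pCons mult.commute)
  qed
  \<comment> \<open>\<open>E\<close> is the geometric series of
    \<open>r / (1 - r X)\<close>.\<close>
  have LE: "L * E = fps_const r"
  proof (rule fps_ext)
    show "(L * E) $ n = fps_const r $ n" for n
      by (cases n) (simp_all add: L_def E_def algebra_simps)
  qed
  have sum: "Abs_fps (\<lambda>k. power_sum (r # rs) (Suc k)) = E + S"
    by (simp add: fps_eq_iff E_def S_def power_sum_def)
  have "fps_deriv (L * G) = - fps_const r * G + L * fps_deriv G"
    by (simp add: L_def algebra_simps flip: fps_const_neg)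
  also have "\<dots> = - (L * E) * G - L * (G * S)"
    using Cons by (simp add: LE G_def S_def)
  also have "\<dots> = - (L * G) * (E + S)"
    by (simp add: algebra_simps)
  finally show ?case unfolding split sum .
qed

lemma newton_identity:
  fixes rs :: "'b::idom list"
  defines "e \<equiv> coeff (reflect_poly (root_poly rs))"
  shows "of_nat (Suc n) * e (Suc n) = - (\<Sum>k\<le>n. e k * power_sum rs (Suc (n - k)))"
proof -
  have "fps_deriv (fps_of_poly (reflect_poly (root_poly rs))) $ n =
      (- fps_of_poly (reflect_poly (root_poly rs)) * Abs_fps (\<lambda>k. power_sum rs (Suc k))) $ n"
    by (simp only: fps_newton)
  then show ?thesis
    by (simp add: e_def fps_mult_nth sum_negf atLeast0AtMost)
qed

context subfield_char_0
begin

lemma reflect_coeffs_in_iff: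
  "(\<forall>n. coeff (reflect_poly p) n \<in> S) \<longleftrightarrow> (\<forall>n. coeff p n \<in> S)"
proof
  assume *: "\<forall>n. coeff (reflect_poly p) n \<in> S"
  show "\<forall>n. coeff p n \<in> S"
  proof
    fix n
    show "coeff p n \<in> S"
      using *[rule_format, of "degree p - n"]
      by (cases "n \<le> degree p") (auto simp: coeff_reflect_poly coeff_eq_0 not_le[symmetric])
  qed
qed (auto simp: coeff_reflect_poly)

text \<open>Since \<open>e 0 = 1\<close>, Newton's identity can be solved for its highest power sum
  without dividing. The power sum of exponent 0 is the number of roots and is treated
  separately.\<close>

lemma power_sums_in:
  assumes "\<forall>n. coeff (root_poly rs) n \<in> S"
  shows "power_sum rs k \<in> S"
proof (induction k rule: less_induct)
  case (less k)
  define e where "e = coeff (reflect_poly (root_poly rs))"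
  have e: "e n \<in> S" for n
    using assms reflect_coeffs_in_iff[of "root_poly rs"] by (simp add: e_def)
  show ?case
  proof (cases k)
    case 0
    then show ?thesis by (simp add: power_sum_def sum_list_triv)
  next
    case (Suc n)
    have "of_nat (Suc n) * e (Suc n) =
        - (e 0 * power_sum rs (Suc n) + (\<Sum>k<n. e (Suc k) * power_sum rs (Suc (n - Suc k))))"
      using newton_identity[of n rs] unfolding e_def[symmetric]
      by (simp add: sum.atMost_shift)
    moreover have "e 0 = 1"
      by (simp add: e_def del: degree_root_poly)
    ultimately have "power_sum rs k =
        - (of_nat (Suc n) * e (Suc n)) - (\<Sum>k<n. e (Suc k) * power_sum rs (Suc (n - Suc k)))"
      using Suc by simp
    moreover have "power_sum rs (Suc (n - Suc j)) \<in> S" if "j < n" for j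
      using less.IH that Suc by simp
    ultimately show ?thesis
      using e by (simp only:) (intro diff uminus sum mult of_nat; simp)
  qed
qed

text \<open>Here Newton's identity is solved for \<open>e k\<close>, which requires division by
  \<open>k\<close>; this is where characteristic zero enters.\<close>

lemma root_poly_coeffs_in:
  assumes p: "\<And>k. power_sum rs k \<in> S"
  shows "coeff (root_poly rs) n \<in> S"
proof -
  define e where "e = coeff (reflect_poly (root_poly rs))"
  have "e n \<in> S" for n
  proof (induction n rule: less_induct)
    case (less k)
    show ?case
    proof (cases k)
      case 0
      then show ?thesis by (simp add: e_def del: degree_root_poly)
    next
      case (Suc n)
      have "of_nat (Suc n) * e (Suc n) = - (\<Sum>k\<le>n. e k * power_sum rs (Suc (n - k)))"
        using newton_identity[of n rs] by (simp add: e_def)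
      then have "e k = - (\<Sum>k\<le>n. e k * power_sum rs (Suc (n - k))) / of_nat k"
        using Suc by (simp add: field_simps del: of_nat_Suc)
      also have "\<dots> \<in> S"
        using less Suc p by (intro sum mult divide uminus of_nat) auto
      finally show ?thesis .
    qed
  qed
  then show ?thesis
    using reflect_coeffs_in_iff[of "root_poly rs"] by (simp add: e_def)
qed

end

section \<open>Unordered pairs of roots\<close>

fun pair_map :: "('b \<Rightarrow> 'b \<Rightarrow> 'c) \<Rightarrow> 'b list \<Rightarrow> 'c list" where
  "pair_map h [] = []"
| "pair_map h (x # xs) = map (h x) xs @ pair_map h xs"

lemma length_pair_map: "2 * length (pair_map h xs) = length xs * (length xs - 1)"
proof (induction xs)
  case (Cons a xs)
  then show ?case by (cases xs) auto
qed simp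

lemma in_set_pair_mapD: "z \<in> set (pair_map h xs) \<Longrightarrow> \<exists>x\<in>set xs. \<exists>y\<in>set xs. z = h x y"
  by (induction xs) auto

text \<open>By symmetry the full double sum counts each pair of positions twice and the diagonal
  once.\<close>

lemma sum_pair_map:
  fixes h :: "'b \<Rightarrow> 'b \<Rightarrow> 'c::comm_ring_1"
  assumes "\<And>x y. h x y = h y x"
  shows "2 * sum_list (pair_map h xs) = (\<Sum>x\<leftarrow>xs. \<Sum>y\<leftarrow>xs. h x y) - (\<Sum>x\<leftarrow>xs. h x x)"
proof (induction xs)
  case (Cons a xs)
  have "(\<Sum>x\<leftarrow>xs. h x a) = (\<Sum>x\<leftarrow>xs. h a x)"
    by (simp add: assms)
  with Cons show ?case
    by (simp add: sum_list_addf algebra_simps)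
qed simp

lemma map_pair_map: "map f (pair_map h xs) = pair_map (\<lambda>x y. f (h x y)) xs"
  by (induction xs) auto

context subfield_char_0
begin

text \<open>The double sum and the diagonal are both polynomials in \<open>t\<close> and the power
  sums of \<open>rs\<close>. The extra monomials \<open>x ^ a * y ^ b\<close> make the inductions on
  the exponent of \<open>h\<close> possible, as expanding one factor \<open>h x y\<close> raises
  \<open>a\<close> and \<open>b\<close>.\<close>

lemma pair_power_sums_in:
  assumes p: "\<And>k. power_sum rs k \<in> S" and t: "t \<in> S"
  shows "power_sum (pair_map (\<lambda>x y. x + y + t * (x * y)) rs) k \<in> S"
proof -
  define h where "h x y = x + y + t * (x * y)" for x y
  have double: "(\<Sum>x\<leftarrow>rs. \<Sum>y\<leftarrow>rs. x ^ a * y ^ b * h x y ^ m) \<in> S" for a b m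
  proof (induction m arbitrary: a b)
    case 0
    have "(\<Sum>x\<leftarrow>rs. \<Sum>y\<leftarrow>rs. x ^ a * y ^ b) = power_sum rs a * power_sum rs b"
      by (simp add: power_sum_def sum_list_mult_const sum_list_const_mult)
    then show ?case using p by auto
  next
    case (Suc m)
    have "x ^ a * y ^ b * h x y ^ Suc m = x ^ Suc a * y ^ b * h x y ^ m
        + x ^ a * y ^ Suc b * h x y ^ m + t * (x ^ Suc a * y ^ Suc b * h x y ^ m)" for x y
      by (simp add: h_def algebra_simps)
    then have "(\<Sum>x\<leftarrow>rs. \<Sum>y\<leftarrow>rs. x ^ a * y ^ b * h x y ^ Suc m) =
        (\<Sum>x\<leftarrow>rs. \<Sum>y\<leftarrow>rs. x ^ Suc a * y ^ b * h x y ^ m)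
        + (\<Sum>x\<leftarrow>rs. \<Sum>y\<leftarrow>rs. x ^ a * y ^ Suc b * h x y ^ m)
        + t * (\<Sum>x\<leftarrow>rs. \<Sum>y\<leftarrow>rs. x ^ Suc a * y ^ Suc b * h x y ^ m)"
      by (simp only: sum_list_addf sum_list_const_mult)
    then show ?case using Suc t by (auto simp del: power_Suc)
  qed
  have diagonal: "(\<Sum>x\<leftarrow>rs. x ^ a * h x x ^ m) \<in> S" for a m
  proof (induction m arbitrary: a)
    case 0
    show ?case using p[of a] by (simp add: power_sum_def)
  next
    case (Suc m)
    have "x ^ a * h x x ^ Suc m = 2 * (x ^ Suc a * h x x ^ m) + t * (x ^ (a + 2) * h x x ^ m)" for x
      by (simp add: h_def algebra_simps power2_eq_square)
    then have "(\<Sum>x\<leftarrow>rs. x ^ a * h x x ^ Suc m) =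
        2 * (\<Sum>x\<leftarrow>rs. x ^ Suc a * h x x ^ m) + t * (\<Sum>x\<leftarrow>rs. x ^ (a + 2) * h x x ^ m)"
      by (simp only: sum_list_addf sum_list_const_mult)
    then show ?case using Suc t by (simp only:) (intro add mult numeral)
  qed
  have "2 * power_sum (pair_map h rs) k =
      (\<Sum>x\<leftarrow>rs. \<Sum>y\<leftarrow>rs. h x y ^ k) - (\<Sum>x\<leftarrow>rs. h x x ^ k)"
    unfolding power_sum_def map_pair_map
    by (rule sum_pair_map) (simp add: h_def add_ac mult_ac)
  also have "\<dots> \<in> S"
    using double[of 0 0 k] diagonal[of 0 k] by auto
  finally have "(2 * power_sum (pair_map h rs) k) / 2 \<in> S"
    by (rule divide) simp
  then show ?thesis by (simp add: h_def[abs_def])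
qed

end

section \<open>The field \<open>K(i)\<close> inside the algebraic closure\<close>

locale imaginary_unit =
  fixes \<ii> :: "'a::linordered_field alg_closure"
  assumes square: "\<ii> * \<ii> = -1"
begin

definition complexes :: "'a alg_closure set" where
  "complexes = {to_ac a + to_ac b * \<ii> | a b. True}"

lemma complexesI: "z = to_ac a + to_ac b * \<ii> \<Longrightarrow> z \<in> complexes"
  unfolding complexes_def by blast

lemma to_ac_complexes [simp]: "to_ac a \<in> complexes"
  by (rule complexesI[of _ a 0]) simp

lemma square_cancel [simp]: "\<ii> * (\<ii> * x) = - x"
  using square by (simp flip: mult.assoc)

text \<open>The norm \<open>a * a + b * b\<close> is a sum of squares in an ordered field, so it
  vanishes only for \<open>a = b = 0\<close>.\<close>

lemma complex_eq_0_iff: "to_ac a + to_ac b * \<ii> = 0 \<longleftrightarrow> a = 0 \<and> b = 0"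
proof
  assume *: "to_ac a + to_ac b * \<ii> = 0"
  have "to_ac (a * a + b * b) = (to_ac a + to_ac b * \<ii>) * (to_ac a - to_ac b * \<ii>)"
    by (simp add: algebra_simps square)
  then have "a * a + b * b = 0"
    unfolding * by (simp del: to_ac_add to_ac_mult)
  then show "a = 0 \<and> b = 0"
    by (simp add: sum_squares_eq_zero_iff)
qed simp

sublocale C: subfield_char_0 complexes
proof
  show "1 \<in> complexes" by (rule complexesI[of _ 1 0]) simp
next
  fix x y assume "x \<in> complexes" "y \<in> complexes"
  then obtain a b c d where xy: "x = to_ac a + to_ac b * \<ii>" "y = to_ac c + to_ac d * \<ii>"
    by (auto simp: complexes_def)
  show "x + y \<in> complexes"
    by (rule complexesI[of _ "a + c" "b + d"]) (simp add: xy algebra_simps)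
  show "x * y \<in> complexes"
    by (rule complexesI[of _ "a * c - b * d" "a * d + b * c"])
       (simp add: xy algebra_simps square)
next
  fix x assume "x \<in> complexes"
  then obtain a b where x: "x = to_ac a + to_ac b * \<ii>"
    by (auto simp: complexes_def)
  show "- x \<in> complexes"
    by (rule complexesI[of _ "- a" "- b"]) (simp add: x)
  show "inverse x \<in> complexes"
  proof (cases "x = 0")
    case True
    then show ?thesis by (intro complexesI[of _ 0 0]) simp
  next
    case False
    define N where "N = a * a + b * b"
    have "N \<noteq> 0"
      using False x complex_eq_0_iff[of a b] by (simp add: N_def sum_squares_eq_zero_iff)
    then have N: "to_ac N \<noteq> 0" by simp
    have "x * (to_ac (a / N) + to_ac (- b / N) * \<ii>) = x * (to_ac a - to_ac b * \<ii>) / to_ac N"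
      by (simp add: divide_inverse algebra_simps)
    also have "x * (to_ac a - to_ac b * \<ii>) = to_ac N"
      by (simp add: x N_def algebra_simps square)
    also have "to_ac N / to_ac N = 1" using N by simp
    finally show ?thesis
      by (intro complexesI[of _ "a / N" "- b / N"]) (rule inverse_unique)
  qed
qed

text \<open>The usual formula for a complex square root: if \<open>m\<close> is the absolute value
  of \<open>a + b i\<close>, the root has real part \<open>sqrt ((m + a) / 2)\<close> and imaginary
  part \<open>sqrt ((m - a) / 2)\<close> up to sign.\<close>

lemma sqrt_in_complexes:
  assumes rc: "real_closed TYPE('a)" and "w * w \<in> complexes"
  shows "w \<in> complexes"
proof -
  have root: "\<exists>y\<ge>0. x = y * y" if nonneg: "x \<ge> 0" for x :: 'a
  proof -
    obtain y where "x = y * y" using rc[unfolded real_closed_def, THEN conjunct1] nonneg by blast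
    then show ?thesis by (intro exI[of _ "\<bar>y\<bar>"]) simp
  qed
  obtain a b where ab: "w * w = to_ac a + to_ac b * \<ii>"
    using assms(2) by (auto simp: complexes_def)
  obtain m where m: "m \<ge> 0" "a * a + b * b = m * m"
    using root[of "a * a + b * b"] by auto
  have "\<bar>a\<bar> \<le> m"
  proof (rule power2_le_imp_le[OF _ m(1)])
    have "a * a \<le> a * a + b * b" by simp
    then show "\<bar>a\<bar>\<^sup>2 \<le> m\<^sup>2"
      unfolding m(2) by (simp add: power2_eq_square)
  qed
  then have "(m + a) / 2 \<ge> 0" "(m - a) / 2 \<ge> 0" by auto
  then obtain c d where c: "c \<ge> 0" "(m + a) / 2 = c * c" and d: "d \<ge> 0" "(m - a) / 2 = d * d"
    using root by metis
  have a_eq: "c * c - d * d = a"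
    unfolding c(2)[symmetric] d(2)[symmetric] by (simp add: field_simps)
  have "(2 * (c * d)) * (2 * (c * d)) = 4 * ((c * c) * (d * d))"
    by (simp add: algebra_simps)
  also have "\<dots> = m * m - a * a"
    unfolding c(2)[symmetric] d(2)[symmetric] by (simp add: field_simps)
  also have "\<dots> = b * b" by (simp flip: m(2))
  finally have "2 * (c * d) = b \<or> 2 * (c * d) = - b"
    by (simp only: square_eq_iff)
  \<comment> \<open>\<open>d'\<close> is \<open>d\<close> or \<open>- d\<close>, the sign being
    chosen to fit the sign of \<open>b\<close>.\<close>
  then obtain d' where d': "d' * d' = d * d" "2 * (c * d') = b"
    by (metis minus_mult_minus mult_minus_right minus_minus)
  define z where "z = to_ac c + to_ac d' * \<ii>"
  have "z * z = to_ac (c * c - d' * d') + to_ac (2 * (c * d')) * \<ii>"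
    by (simp add: z_def algebra_simps square)
  also have "\<dots> = w * w"
    by (simp only: ab d' a_eq)
  finally have "w = z \<or> w = - z"
    by (metis square_eq_iff minus_minus)
  moreover have "z \<in> complexes" by (auto simp: z_def intro: complexesI)
  ultimately show ?thesis by auto
qed

lemma roots_of_quadratic_in_complexes:
  assumes rc: "real_closed TYPE('a)" and "x + y \<in> complexes" "x * y \<in> complexes"
  shows "x \<in> complexes"
proof -
  have "(x - y) * (x - y) = (x + y) * (x + y) - 4 * (x * y)"
    by (simp add: algebra_simps)
  also have "\<dots> \<in> complexes"
    by (rule C.diff[OF C.mult[OF assms(2,2)] C.mult[OF C.numeral assms(3)]])
  finally have "x - y \<in> complexes"
    by (rule sqrt_in_complexes[OF rc])
  then have "((x + y) + (x - y)) / 2 \<in> complexes"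
    using C.add[OF assms(2)] by (intro C.divide C.numeral)
  then show ?thesis by simp
qed

end

section \<open>Roots in \<open>K(i)\<close> and the resulting factors over \<open>K\<close>\<close>

interpretation to_ac_range: subfield_char_0 "range (to_ac :: 'a::linordered_field \<Rightarrow> _)"
proof
  show "1 \<in> range (to_ac :: 'a \<Rightarrow> _)" by (rule range_eqI[of _ _ 1]) simp
next
  fix x y :: "'a alg_closure"
  assume "x \<in> range to_ac" "y \<in> range to_ac"
  then show "x + y \<in> range to_ac" "x * y \<in> range to_ac"
    by (auto simp flip: to_ac_add to_ac_mult)
qed (auto simp flip: to_ac_minus to_ac_inverse)

lemma map_poly_to_ac_mult:
  "map_poly to_ac (p * q) = map_poly to_ac p * map_poly to_ac q" for p q :: "'a::field poly"
  by (rule poly_eqI) (simp add: coeff_map_poly coeff_mult to_ac_sum)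

lemma map_poly_to_ac_add:
  "map_poly to_ac (p + q) = map_poly to_ac p + map_poly to_ac q" for p q :: "'a::field poly"
  by (rule poly_eqI) (simp add: coeff_map_poly)

lemma poly_map_poly_to_ac: "poly (map_poly to_ac p) (to_ac x) = to_ac (poly p x)"
  for p :: "'a::field poly"
  by (induction p) (simp_all add: map_poly_pCons)

lemma poly_range_to_acE:
  fixes q :: "'a::field alg_closure poly"
  assumes "\<And>n. coeff q n \<in> range to_ac"
  obtains p where "q = map_poly to_ac p"
proof
  show "q = map_poly to_ac (map_poly of_ac q)"
    using assms by (intro poly_eqI) (simp add: coeff_map_poly to_ac_of_ac)
qed

text \<open>The number of unordered pairs of roots has one factor \<open>2\<close> less than the number of roots, so the
  induction hypothesis applies to the numbers \<open>x + y + t x y\<close>.  Two different \<open>t\<close> must give the same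
  pair, which puts \<open>x + y\<close> and \<open>x y\<close> into \<open>K(i)\<close>.\<close>
lemma (in imaginary_unit) root_in_complexes:
  fixes rs :: "'a alg_closure list"
  assumes rc: "real_closed TYPE('a)"
    and "length rs = 2 ^ k * m" "odd m" "\<And>n. coeff (root_poly rs) n \<in> range to_ac"
  shows "\<exists>r\<in>set rs. r \<in> complexes"
  using assms(2-)
proof (induction k arbitrary: rs m)
  case 0
  obtain p where p: "root_poly rs = map_poly to_ac p"
    using poly_range_to_acE 0(3) by blast
  have "degree p = length rs"
    using arg_cong[OF p, of degree] by (simp add: degree_map_poly)
  then obtain x where "poly p x = 0"
    using rc 0 unfolding real_closed_def by auto
  then have "poly (root_poly rs) (to_ac x) = 0"
    by (simp add: p poly_map_poly_to_ac)
  then show ?case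
    unfolding poly_root_poly_eq_0_iff using to_ac_complexes by blast
next
  case (Suc k)
  define h where "h t x y = x + y + to_ac (of_nat t) * (x * y)" for t and x y :: "'a alg_closure"
  have "\<exists>x\<in>set rs. \<exists>y\<in>set rs. h t x y \<in> complexes" for t
  proof -
    have "2 * length (pair_map (h t) rs) = 2 * (2 ^ k * (m * (length rs - 1)))"
      using Suc.prems(1) by (simp add: length_pair_map)
    then have "length (pair_map (h t) rs) = 2 ^ k * (m * (length rs - 1))"
      by simp
    \<comment> \<open>\<open>length rs\<close> is even because of the factor
      \<open>2 ^ Suc k\<close>, so \<open>length rs - 1\<close> is odd.\<close>
    moreover have "odd (m * (length rs - 1))"
      using Suc.prems(1,2) by (auto simp: odd_pos)
    moreover have "coeff (root_poly (pair_map (h t) rs)) n \<in> range to_ac" for n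
    proof (rule to_ac_range.root_poly_coeffs_in)
      show "power_sum (pair_map (h t) rs) j \<in> range to_ac" for j
        unfolding h_def
        by (rule to_ac_range.pair_power_sums_in)
           (use Suc.prems(3) in \<open>auto intro: to_ac_range.power_sums_in\<close>)
    qed
    ultimately have "\<exists>z\<in>set (pair_map (h t) rs). z \<in> complexes"
      by (rule Suc.IH)
    then show ?thesis by (metis in_set_pair_mapD)
  qed
  then obtain f g where fg: "\<And>t. f t \<in> set rs" "\<And>t. g t \<in> set rs"
    "\<And>t. h t (f t) (g t) \<in> complexes"
    by metis
  have "range (\<lambda>t. (f t, g t)) \<subseteq> set rs \<times> set rs"
    using fg by auto
  then have "finite (range (\<lambda>t. (f t, g t)))"
    by (rule finite_subset) simp
  then have "\<not> inj (\<lambda>t. (f t, g t))"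
    using finite_imageD infinite_UNIV_nat by blast
  then obtain s t where st: "s \<noteq> t" "f s = f t" "g s = g t"
    by (auto simp: inj_def)
  define x y where "x = f t" and "y = g t"
  have hs: "h s x y \<in> complexes" and ht: "h t x y \<in> complexes"
    using fg(3)[of s] fg(3)[of t] st by (simp_all add: x_def y_def)
  have ne: "of_nat s - of_nat t \<noteq> (0 :: 'a alg_closure)"
    using st(1) by simp
  have "x * y = (h s x y - h t x y) / (of_nat s - of_nat t)"
    using ne by (simp add: h_def field_simps)
  also have "\<dots> \<in> complexes"
    using hs ht by (intro C.divide C.diff C.of_nat)
  finally have prod: "x * y \<in> complexes" .
  have "x + y = h t x y - of_nat t * (x * y)"
    by (simp add: h_def)
  also have "\<dots> \<in> complexes"
    by (rule C.diff[OF ht C.mult[OF C.of_nat prod]])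
  finally have "x \<in> complexes"
    using prod roots_of_quadratic_in_complexes[OF rc] by blast
  then show ?case using fg(1) x_def by blast
qed

text \<open>Some root \<open>z = a + b i\<close> of \<open>p\<close> lies in \<open>K(i)\<close>. If
  \<open>b = 0\<close> it lies in \<open>K\<close>; otherwise \<open>(X - a)^2 + b^2\<close> is its
  minimal polynomial over \<open>K\<close>.\<close>

theorem real_closed_linear_or_quadratic_factor:
  fixes p :: "'a::linordered_field poly"
  assumes rc: "real_closed TYPE('a)" and deg: "degree p > 0"
  shows "(\<exists>x. poly p x = 0) \<or> (\<exists>a b. b \<noteq> 0 \<and> [:a * a + b * b, - 2 * a, 1:] dvd p)"
proof -
  obtain \<ii> :: "'a alg_closure" where "\<ii> ^ 2 = -1"
    using nth_root_exists[of 2 "-1 :: 'a alg_closure"] by auto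
  then interpret imaginary_unit \<ii>
    by unfold_locales (simp add: power2_eq_square)
  define c where "c = inverse (lead_coeff p)"
  define q where "q = map_poly to_ac (smult c p)"
  have p0: "p \<noteq> 0" using deg by auto
  have c: "c \<noteq> 0" "c * lead_coeff p = 1" using p0 by (simp_all add: c_def)
  have degq: "degree q = degree p"
    using c by (simp add: q_def degree_map_poly)
  have lcq: "lead_coeff q = 1"
    unfolding degq using c by (simp add: q_def coeff_map_poly flip: to_ac_mult)
  have "q \<noteq> 0" using lcq by auto
  then obtain A where A: "size A = degree q" "q = smult (lead_coeff q) (\<Prod>x\<in>#A. [:-x, 1:])"
    using alg_closed_imp_factorization by blast
  obtain rs where "mset rs = A" using ex_mset by blast
  then have rs: "length rs = degree p" "q = root_poly rs"
    using A degq lcq by (auto simp: root_poly_def prod_mset_prod_list simp flip: mset_map)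
  obtain m where m: "length rs = 2 ^ multiplicity 2 (length rs) * m" "odd m"
    using multiplicity_decompose'[of "length rs" 2] deg rs(1) by auto
  have "coeff (root_poly rs) n \<in> range to_ac" for n
    unfolding rs(2)[symmetric] q_def by (simp add: coeff_map_poly del: to_ac_mult)
  then obtain z where z: "z \<in> set rs" "z \<in> complexes"
    using root_in_complexes[OF rc m] by blast
  then obtain a b where ab: "z = to_ac a + to_ac b * \<ii>"
    by (auto simp: complexes_def)
  have "poly q z = 0"
    using z rs by (simp add: poly_root_poly_eq_0_iff)
  then have pz: "poly (map_poly to_ac p) z = 0"
    using c by (simp add: q_def map_poly_smult)
  show ?thesis
  proof (cases "b = 0")
    case True
    then have "poly p a = 0"
      using pz by (simp add: ab poly_map_poly_to_ac)
    then show ?thesis by blast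
  next
    case False
    define d where "d = [:a * a + b * b, - 2 * a, 1:]"
    \<comment> \<open>The remainder is at most linear and vanishes at \<open>z\<close>; as
      \<open>b \<noteq> 0\<close>, independence of \<open>1\<close> and \<open>i\<close> over
      \<open>K\<close> forces it to be 0.\<close>
    define r where "r = p mod d"
    have "degree r < 2"
      using degree_mod_less'[of d p] by (cases "r = 0") (auto simp: d_def r_def)
    then have "r = [:coeff r 0, coeff r 1:]"
      by (intro poly_eqI) (auto simp: coeff_pCons coeff_eq_0 split: nat.split)
    then obtain u w where r: "r = [:u, w:]" by blast
    have dz: "poly (map_poly to_ac d) z = 0"
      by (simp add: d_def ab map_poly_pCons algebra_simps square)
    have "p = p div d * d + r" by (simp add: r_def)
    then have "map_poly to_ac p = map_poly to_ac (p div d) * map_poly to_ac d + map_poly to_ac r"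
      by (metis map_poly_to_ac_mult map_poly_to_ac_add)
    then have "poly (map_poly to_ac r) z = 0"
      using pz dz by simp
    then have "to_ac (u + a * w) + to_ac (b * w) * \<ii> = 0"
      by (simp add: r ab map_poly_pCons algebra_simps)
    then have "u = 0 \<and> w = 0"
      using False by (simp only: complex_eq_0_iff) auto
    then have "d dvd p" using r by (simp add: r_def dvd_eq_mod_eq_0)
    then show ?thesis using False d_def by blast
  qed
qed

section \<open>Sign changes\<close>

text \<open>The last nonzero value strictly before index \<open>n\<close>. The default 0 ensures
  that the first nonzero value is not counted as a change.\<close>

primrec last_sign :: "(nat \<Rightarrow> 'a::linordered_idom) \<Rightarrow> nat \<Rightarrow> 'a" where
  "last_sign s 0 = 0"
| "last_sign s (Suc n) = (if s n = 0 then last_sign s n else s n)"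

primrec changes :: "(nat \<Rightarrow> 'a::linordered_idom) \<Rightarrow> nat \<Rightarrow> nat" where
  "changes s 0 = 0"
| "changes s (Suc n) = changes s n + (if last_sign s n * s n < 0 then 1 else 0)"

lemma zip_tl_snoc: "xs \<noteq> [] \<Longrightarrow> zip (xs @ [x]) (tl (xs @ [x])) = zip xs (tl xs) @ [(last xs, x)]"
  by (induction xs rule: list_nonempty_induct) (auto simp: neq_Nil_conv)

lemma sign_changes_list_map_upt:
  "sign_changes_list (map s [0..<n]) = changes s n"
proof (induction n)
  case 0
  show ?case by (simp add: sign_changes_list_def)
next
  case (Suc n)
  define ys where "ys = filter (\<lambda>x. x \<noteq> 0) (map s [0..<n])"
  have last: "last_sign s n = (if ys = [] then 0 else last ys)"
    unfolding ys_def by (induction n) auto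
  have IH: "changes s n = length (filter (\<lambda>(x, y). x * y < 0) (zip ys (tl ys)))"
    using Suc by (simp add: sign_changes_list_def ys_def Let_def)
  show ?case
  proof (cases "s n = 0")
    case True
    then show ?thesis using Suc by (simp add: sign_changes_list_def)
  next
    case False
    then have "sign_changes_list (map s [0..<Suc n]) =
        length (filter (\<lambda>(x, y). x * y < 0) (zip (ys @ [s n]) (tl (ys @ [s n]))))"
      by (simp add: sign_changes_list_def ys_def Let_def)
    also have "\<dots> = changes s (Suc n)"
      by (cases "ys = []") (simp_all add: zip_tl_snoc last IH del: tl_append2)
    finally show ?thesis .
  qed
qed

lemma changes_last_sign_beyond:
  assumes "\<And>i. i \<ge> m \<Longrightarrow> s i = 0" "m \<le> n"
  shows "changes s n = changes s m" "last_sign s n = last_sign s m"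
  using assms(2) by (induction n rule: dec_induct) (simp_all add: assms(1))

lemma sign_changes_eq_changes:
  assumes "degree p < n"
  shows "sign_changes p = changes (coeff p) n"
proof (cases "p = 0")
  case True
  have "changes (coeff (0 :: 'a poly)) n = 0"
    by (induction n) auto
  then show ?thesis using True by (simp add: sign_changes_def sign_changes_list_def)
next
  case False
  then have "sign_changes p = changes (coeff p) (Suc (degree p))"
    by (simp add: sign_changes_def coeffs_def sign_changes_list_map_upt del: upt_Suc changes.simps)
  also have "\<dots> = changes (coeff p) n"
    using assms by (intro changes_last_sign_beyond(1)[symmetric]) (auto simp: coeff_eq_0)
  finally show ?thesis .
qed

lemma last_sign_zeros: "(\<And>i. i < n \<Longrightarrow> s i = 0) \<Longrightarrow> last_sign s n = 0 \<and> changes s n = 0"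
  by (induction n) auto

lemma last_sign_nonzero: "s a \<noteq> 0 \<Longrightarrow> a < n \<Longrightarrow> last_sign s n \<noteq> 0"
  by (induction n) (auto simp: less_Suc_eq)

lemma mult_pos_iff_sign_change:
  fixes x y z :: "'a::linordered_idom"
  assumes "x \<noteq> 0" "y \<noteq> 0" "z \<noteq> 0"
  shows "x * z > 0 \<longleftrightarrow> (if y * z < 0 then \<not> x * y > 0 else x * y > 0)"
proof -
  have "x < 0 \<or> 0 < x" "y < 0 \<or> 0 < y" "z < 0 \<or> 0 < z"
    using assms by auto
  then show ?thesis
    by (elim disjE) (simp_all add: zero_less_mult_iff mult_less_0_iff)
qed

text \<open>Each change reverses the sign of the last nonzero entry relative to
  \<open>s a\<close>.\<close>

lemma even_changes_iff:
  assumes first: "\<And>i. i < a \<Longrightarrow> s i = 0" and a: "s a \<noteq> 0" and "a < n"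
  shows "even (changes s n) \<longleftrightarrow> s a * last_sign s n > 0"
proof -
  from \<open>a < n\<close> have "Suc a \<le> n" by simp
  then show ?thesis
  proof (induction n rule: dec_induct)
    case base
    then show ?case
      using last_sign_zeros[of a s] first a by (simp add: not_square_less_zero less_le)
  next
    case (step n)
    have "last_sign s n \<noteq> 0"
      using a step by (intro last_sign_nonzero) auto
    then show ?case
      using step(3) mult_pos_iff_sign_change[OF a, of "last_sign s n" "s n"] by simp
  qed
qed

lemma even_changes_iff_ends:
  assumes "\<And>i. i < a \<Longrightarrow> s i = 0" "\<And>i. i > b \<Longrightarrow> s i = 0"
    and "s a \<noteq> 0" "s b \<noteq> 0" "b < n"
  shows "even (changes s n) \<longleftrightarrow> s a * s b > 0"
proof -
  have "a \<le> b" using assms by (meson not_le)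
  have "last_sign s n = last_sign s (Suc b)"
    using assms by (intro changes_last_sign_beyond) auto
  then show ?thesis
    using even_changes_iff[of a s n] assms \<open>a \<le> b\<close> by simp
qed

text \<open>The step of Descartes' rule: \<open>s\<close> and \<open>s'\<close> stand for the coefficient signs of
  \<open>R\<close> and of \<open>(X - \<alpha>) R\<close> with \<open>\<alpha> > 0\<close>; nothing is known about \<open>s'\<close> where
  the two contributions may cancel.  The invariant relates the last coefficient sign \<open>p\<close> of \<open>R\<close>
  read so far, the last nonzero signs \<open>q\<close>, \<open>q'\<close> and the numbers \<open>A\<close>, \<open>B\<close> of changes.\<close>
definition descartes_inv :: "'a::linordered_idom \<Rightarrow> 'a \<Rightarrow> 'a \<Rightarrow> nat \<Rightarrow> nat \<Rightarrow> bool" where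
  "descartes_inv p q q' A B \<longleftrightarrow>
     (if q = 0 then p = 0 \<and> q' = 0 \<and> A \<le> B
      else q' \<noteq> 0 \<and>
        (if p = 0 then A + 1 \<le> B \<and> q' = q
         else q = p \<and> A \<le> B \<and> (A = B \<longrightarrow> q' = - p)))"

text \<open>The value \<open>y\<close> is free only for \<open>x = p \<noteq> 0\<close>. In a tie
  \<open>A = B\<close> then \<open>q' = - p\<close>, so \<open>y = p\<close> makes \<open>B\<close>
  larger and any other \<open>y\<close> preserves the tie condition. For \<open>x = 0\<close> or
  \<open>x = - p\<close> one gets \<open>y = p\<close>, which is a change for \<open>s'\<close> in a
  tie; this yields the surplus or keeps pace with the change of \<open>s\<close>.\<close>

lemma descartes_inv_step:
  fixes p q q' x y :: "'a::linordered_idom"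
  assumes "descartes_inv p q q' A B"
    and "p \<in> {-1, 0, 1}" "q \<in> {-1, 0, 1}" "q' \<in> {-1, 0, 1}" "x \<in> {-1, 0, 1}" "y \<in> {-1, 0, 1}"
    and "p * x \<le> 0 \<Longrightarrow> y = sgn (p - x)"
  shows "descartes_inv x (if x = 0 then q else x) (if y = 0 then q' else y)
           (A + (if q * x < 0 then 1 else 0)) (B + (if q' * y < 0 then 1 else 0))"
proof -
  have x: "x = -1 \<or> x = 0 \<or> x = 1" and y: "y = -1 \<or> y = 0 \<or> y = 1"
    using assms(5,6) by auto
  consider "q = 0" "p = 0" "q' = 0" "A \<le> B" | "q = 1 \<or> q = -1" "p = 0" "q' = q" "A + 1 \<le> B"
    | "p = 1 \<or> p = -1" "q = p" "q' = 1 \<or> q' = -1" "A \<le> B" "A = B \<longrightarrow> q' = - p"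
    using assms(1-4) unfolding descartes_inv_def by (auto split: if_splits)
  then show ?thesis
  proof cases
    case 1
    then have "y = sgn (- x)" using assms(7) by simp
    with 1 x show ?thesis by (elim disjE) (simp_all add: descartes_inv_def)
  next
    case 2
    then have "y = sgn (- x)" using assms(7) by simp
    with 2 x show ?thesis by (elim disjE) (simp_all add: descartes_inv_def)
  next
    case 3
    show ?thesis
    proof (cases "x = p")
      case True
      with 3 y show ?thesis by (elim disjE) (simp_all add: descartes_inv_def)
    next
      case False
      with 3(1) x have x': "x = 0 \<or> x = - p" by auto
      have "p * x \<le> 0" "sgn (p - x) = p" using 3(1) x' by auto
      then have "y = p" using assms(7) by simp
      with 3 x' show ?thesis by (elim disjE) (simp_all add: descartes_inv_def)
    qed
  qed
qed

lemma last_sign_in: "(\<And>i. s i \<in> {-1, 0, 1}) \<Longrightarrow> last_sign s n \<in> {-1, 0, 1}"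
  by (induction n) auto

lemma changes_descartes_step:
  fixes s s' :: "nat \<Rightarrow> 'a::linordered_idom"
  assumes signs: "\<And>i. s i \<in> {-1, 0, 1}" "\<And>i. s' i \<in> {-1, 0, 1}"
    and s'0: "s' 0 = - s 0"
    and s'_Suc: "\<And>i. s i * s (Suc i) \<le> 0 \<Longrightarrow> s' (Suc i) = sgn (s i - s (Suc i))"
    and nz: "s a \<noteq> 0" and fin: "\<And>i. i \<ge> n \<Longrightarrow> s i = 0"
  shows "changes s' (Suc n) \<ge> changes s n + 1"
proof -
  have "descartes_inv (s k) (last_sign s (Suc k)) (last_sign s' (Suc k))
      (changes s (Suc k)) (changes s' (Suc k))" for k
  proof (induction k)
    case 0
    then show ?case using s'0 by (simp add: descartes_inv_def)
  next
    case (Suc k)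
    from descartes_inv_step[OF Suc signs(1) last_sign_in[OF signs(1)] last_sign_in[OF signs(2)]
        signs(1) signs(2) s'_Suc]
    show ?case
      unfolding last_sign.simps(2)[of _ "Suc k"] changes.simps(2)[of _ "Suc k"] .
  qed
  from this[of n] have "descartes_inv (s n) (last_sign s (Suc n)) (last_sign s' (Suc n))
      (changes s (Suc n)) (changes s' (Suc n))" .
  \<comment> \<open>The zero after the last coefficient puts the invariant into its case
    \<open>p = 0\<close>, where \<open>A + 1 \<le> B\<close>.\<close>
  moreover have "s n = 0" using fin by simp
  moreover have "a < n" using nz fin by (meson not_le)
  then have "last_sign s (Suc n) \<noteq> 0"
    using nz by (intro last_sign_nonzero[of s a]) auto
  ultimately show ?thesis
    unfolding descartes_inv_def by (simp del: changes.simps(2)) simp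
qed

section \<open>Initial forms\<close>

locale convex_valuation =
  fixes v :: "'a::linordered_field \<Rightarrow> ereal"
  assumes val: "valuation v" and nonarch: "non_archimedean_ordered v"
begin

lemma v_0 [simp]: "v 0 = \<infinity>"
  using val by (simp add: valuation_def)

lemma v_finite: "x \<noteq> 0 \<Longrightarrow> \<exists>r. v x = ereal r"
  using val by (simp add: valuation_def)

lemma v_ereal_nonzero: "v x = ereal r \<Longrightarrow> x \<noteq> 0"
  by auto

lemma v_mult: "v (x * y) = v x + v y"
proof (cases "x = 0 \<or> y = 0")
  case True
  then show ?thesis using v_finite by (cases "x = 0"; cases "y = 0") auto
next
  case False
  then show ?thesis using val by (simp add: valuation_def)
qed

lemma v_add: "min (v x) (v y) \<le> v (x + y)"
  using val by (simp add: valuation_def)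

lemma v_1 [simp]: "v 1 = 0"
  using v_finite[of 1] v_mult[of 1 1] by (auto simp: zero_ereal_def)

lemma v_minus [simp]: "v (- x) = v x"
proof -
  have "v (-1) = 0"
    using v_finite[of "-1"] v_mult[of "-1" "-1"] by (auto simp: zero_ereal_def)
  then show ?thesis using v_mult[of "-1" x] by simp
qed

text \<open>The quotient \<open>x / y\<close> lies between -1 and 1, so convexity puts it into the
  valuation ring.\<close>

lemma v_antimono: "v y \<le> v x" if "\<bar>x\<bar> \<le> \<bar>y\<bar>"
proof (cases "y = 0")
  case False
  have "\<bar>x / y\<bar> \<le> 1"
    using that False by (simp add: abs_divide)
  then have "v (x / y) \<ge> 0"
    using nonarch abs_le_iff[of "x / y" 1] minus_le_iff[of "x / y" 1]
    unfolding non_archimedean_ordered_def by (metis v_1 order_refl)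
  moreover have "v x = v (x / y) + v y"
    using False by (simp flip: v_mult)
  ultimately show ?thesis
    by (simp add: ereal_le_add_self2)
qed (use that in simp)

lemma v_add_ge: "\<theta> \<le> v x \<Longrightarrow> \<theta> \<le> v y \<Longrightarrow> \<theta> \<le> v (x + y)"
  using v_add[of x y] by (auto simp: min_le_iff_disj)

lemma v_add_gt: "\<theta> < v x \<Longrightarrow> \<theta> < v y \<Longrightarrow> \<theta> < v (x + y)"
  using v_add[of x y] by (auto simp: min_le_iff_disj)

lemma v_sum_ge: "(\<And>x. x \<in> A \<Longrightarrow> \<theta> \<le> v (f x)) \<Longrightarrow> \<theta> \<le> v (sum f A)"
  by (induction A rule: infinite_finite_induct) (auto intro: v_add_ge)

lemma v_sum_gt: "\<theta> < \<infinity> \<Longrightarrow> (\<And>x. x \<in> A \<Longrightarrow> \<theta> < v (f x)) \<Longrightarrow> \<theta> < v (sum f A)"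
  by (induction A rule: infinite_finite_induct) (auto intro: v_add_gt)

text \<open>If \<open>v (x + y)\<close> exceeded \<open>v x\<close>, so would the valuation of
  \<open>x = (x + y) - y\<close>. The sign is that of \<open>x\<close> because smaller valuation
  means larger absolute value.\<close>

lemma v_add_dominant:
  assumes "v x < v y"
  shows "v (x + y) = v x" "sgn (x + y) = sgn x"
proof -
  have "\<not> v x < v (x + y)"
    using v_add_gt[of "v x" "x + y" "- y"] assms by auto
  then show "v (x + y) = v x"
    using v_add_ge[of "v x" x y] assms by simp
  have "\<bar>y\<bar> < \<bar>x\<bar>"
    using assms v_antimono[of x y] by (meson leD not_le)
  then show "sgn (x + y) = sgn x"
    by (auto simp: sgn_if abs_if split: if_splits)
qed

text \<open>For \<open>v x \<ge> \<theta>\<close> and \<open>t > 0\<close> with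
  \<open>v t = \<theta>\<close>, this is the sign of the residue class of
  \<open>x / t\<close>.\<close>

definition vsgn :: "ereal \<Rightarrow> 'a \<Rightarrow> 'a" where
  "vsgn \<theta> x = (if v x = \<theta> then sgn x else 0)"

lemma vsgn_in: "vsgn \<theta> x \<in> {-1, 0, 1}"
  by (simp add: vsgn_def sgn_if)

lemma vsgn_minus: "vsgn \<theta> (- x) = - vsgn \<theta> x"
  by (simp add: vsgn_def)

text \<open>Terms on the line with equal signs cannot cancel:
  \<open>\<bar>x\<bar> \<le> \<bar>x + y\<bar>\<close> bounds \<open>v (x + y)\<close> from above by
  \<open>v x\<close>. If only one term is on the line, it dominates.\<close>

lemma vsgn_add:
  assumes "ereal r \<le> v x" "ereal r \<le> v y" "vsgn (ereal r) x * vsgn (ereal r) y \<ge> 0"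
  shows "vsgn (ereal r) (x + y) = sgn (vsgn (ereal r) x + vsgn (ereal r) y)"
proof (cases "v x = ereal r"; cases "v y = ereal r")
  assume xy: "v x = ereal r" "v y = ereal r"
  then have nz: "x \<noteq> 0" "y \<noteq> 0" by auto
  have same: "sgn x * sgn y \<ge> 0" using assms(3) xy by (simp add: vsgn_def)
  have "\<bar>x\<bar> \<le> \<bar>x + y\<bar>" and sgn: "sgn (x + y) = sgn x" "sgn y = sgn x"
    using same nz by (auto simp: sgn_if split: if_splits)
  then have "v (x + y) \<le> ereal r"
    using v_antimono xy(1) by metis
  moreover have "ereal r \<le> v (x + y)"
    using assms by (intro v_add_ge)
  ultimately show ?thesis
    using xy nz sgn by (auto simp: vsgn_def sgn_if)
next
  assume "v x = ereal r" "v y \<noteq> ereal r"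
  moreover from this have "v x < v y" using assms by auto
  ultimately show ?thesis
    using v_add_dominant[of x y] by (simp add: vsgn_def)
next
  assume "v x \<noteq> ereal r" "v y = ereal r"
  moreover from this have "v y < v x" using assms by auto
  ultimately show ?thesis
    using v_add_dominant[of y x] by (simp add: vsgn_def add.commute)
next
  assume "v x \<noteq> ereal r" "v y \<noteq> ereal r"
  moreover from this have "ereal r < v x" "ereal r < v y" using assms by auto
  ultimately show ?thesis
    using v_add_gt[of "ereal r" x y] by (auto simp: vsgn_def)
qed

end

text \<open>\<open>tip \<epsilon> G f a\<close> says that the line of slope \<open>\<mu>\<close> and intercept \<open>G\<close> supports the Newton polygon
  of \<open>f\<close> and meets it first (\<open>\<epsilon> = 1\<close>) or last (\<open>\<epsilon> = -1\<close>) at the index \<open>a\<close>.\<close>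
locale newton_line = convex_valuation +
  fixes \<mu> :: real
begin

definition line :: "real \<Rightarrow> nat \<Rightarrow> ereal" where
  "line G i = ereal (G + \<mu> * real i)"

lemma line_finite [simp]: "line G i < \<infinity>" "line G i \<noteq> \<infinity>"
  by (simp_all add: line_def)

lemma line_add: "line G i + line H j = line (G + H) (i + j)"
  by (simp add: line_def algebra_simps)

definition tip :: "int \<Rightarrow> real \<Rightarrow> 'a poly \<Rightarrow> nat \<Rightarrow> bool" where
  "tip \<epsilon> G f a \<longleftrightarrow> v (coeff f a) = line G a \<and> (\<forall>i. line G i \<le> v (coeff f i)) \<and>
     (\<forall>i. \<epsilon> * int i < \<epsilon> * int a \<longrightarrow> line G i < v (coeff f i))"

lemma tip_nonzero: "tip \<epsilon> G f a \<Longrightarrow> coeff f a \<noteq> 0"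
  by (auto simp: tip_def line_def)

lemma ereal_add_le_less_mono:
  "a \<le> c \<Longrightarrow> b < d \<Longrightarrow> a \<noteq> -\<infinity> \<Longrightarrow> a < \<infinity> \<Longrightarrow> a + b < c + d" for a b c d :: ereal
  by (cases a; cases b; cases c; cases d) auto

text \<open>If \<open>i + j = a + b\<close> and \<open>i \<noteq> a\<close>, then \<open>i\<close>
  precedes \<open>a\<close> or \<open>j\<close> precedes \<open>b\<close> in the order of indices
  given by \<open>\<epsilon>\<close>, so this term lies strictly above the line. The term of
  \<open>a\<close> and \<open>b\<close> thus dominates the coefficient.\<close>

lemma tip_mult:
  assumes \<epsilon>: "\<epsilon> \<noteq> 0" and f: "tip \<epsilon> G f a" and g: "tip \<epsilon> H g b"
  shows "tip \<epsilon> (G + H) (f * g) (a + b)"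
    and "sgn (coeff (f * g) (a + b)) = sgn (coeff f a) * sgn (coeff g b)"
proof -
  have ge: "line (G + H) (i + j) \<le> v (coeff f i * coeff g j)" for i j
    using f g by (auto simp: tip_def v_mult simp flip: line_add intro: add_mono)
  have gt: "line (G + H) (i + j) < v (coeff f i * coeff g j)"
    if "\<epsilon> * int i < \<epsilon> * int a \<or> \<epsilon> * int j < \<epsilon> * int b" for i j
    using that
  proof
    assume "\<epsilon> * int i < \<epsilon> * int a"
    then have "line H j + line G i < v (coeff g j) + v (coeff f i)"
      using f g by (intro ereal_add_le_less_mono) (auto simp: tip_def line_def)
    then show ?thesis by (simp add: v_mult add.commute flip: line_add)
  next
    assume "\<epsilon> * int j < \<epsilon> * int b"
    then have "line G i + line H j < v (coeff f i) + v (coeff g j)"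
      using f g by (intro ereal_add_le_less_mono) (auto simp: tip_def line_def)
    then show ?thesis by (simp add: v_mult flip: line_add)
  qed
  define R where "R = (\<Sum>i\<in>{..a + b} - {a}. coeff f i * coeff g (a + b - i))"
  have split: "coeff (f * g) (a + b) = coeff f a * coeff g b + R"
    unfolding R_def coeff_mult by (subst sum.remove[of _ a]) auto
  have main: "v (coeff f a * coeff g b) = line (G + H) (a + b)"
    using f g by (simp add: tip_def v_mult flip: line_add)
  have "line (G + H) (a + b) < v R"
    unfolding R_def
  proof (rule v_sum_gt)
    fix i assume i: "i \<in> {..a + b} - {a}"
    have "line (G + H) (i + (a + b - i)) < v (coeff f i * coeff g (a + b - i))"
    proof (rule gt)
      have "\<epsilon> * int i \<noteq> \<epsilon> * int a" using i \<epsilon> by simp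
      moreover have "\<epsilon> * int (a + b - i) = \<epsilon> * int a + \<epsilon> * int b - \<epsilon> * int i"
        using i by (simp add: of_nat_diff algebra_simps)
      ultimately show "\<epsilon> * int i < \<epsilon> * int a \<or> \<epsilon> * int (a + b - i) < \<epsilon> * int b"
        by linarith
    qed
    then show "line (G + H) (a + b) < v (coeff f i * coeff g (a + b - i))"
      using i by simp
  qed simp
  then have dom: "v (coeff f a * coeff g b) < v R" by (simp add: main)
  show "tip \<epsilon> (G + H) (f * g) (a + b)"
    unfolding tip_def
  proof (intro conjI allI impI)
    show "v (coeff (f * g) (a + b)) = line (G + H) (a + b)"
      unfolding split v_add_dominant(1)[OF dom] by (rule main)
  next
    fix k
    show "line (G + H) k \<le> v (coeff (f * g) k)"
      unfolding coeff_mult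
    proof (rule v_sum_ge)
      show "line (G + H) k \<le> v (coeff f i * coeff g (k - i))" if "i \<in> {..k}" for i
        using ge[of i "k - i"] that by simp
    qed
  next
    fix k assume k: "\<epsilon> * int k < \<epsilon> * int (a + b)"
    show "line (G + H) k < v (coeff (f * g) k)"
      unfolding coeff_mult
    proof (rule v_sum_gt)
      fix i assume i: "i \<in> {..k}"
      have "line (G + H) (i + (k - i)) < v (coeff f i * coeff g (k - i))"
      proof (rule gt)
        show "\<epsilon> * int i < \<epsilon> * int a \<or> \<epsilon> * int (k - i) < \<epsilon> * int b"
          using i k by (auto simp: of_nat_diff algebra_simps)
      qed
      then show "line (G + H) k < v (coeff f i * coeff g (k - i))" using i by simp
    qed simp
  qed
  show "sgn (coeff (f * g) (a + b)) = sgn (coeff f a) * sgn (coeff g b)"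
    unfolding split v_add_dominant(2)[OF dom] by (rule sgn_mult)
qed

lemma tip_unique:
  assumes f: "tip \<epsilon> G f a" and g: "tip \<epsilon> H f b" and \<epsilon>: "\<epsilon> \<noteq> 0"
  shows "G = H" "a = b"
proof -
  have "line H a \<le> line G a" "line G b \<le> line H b"
    using f g unfolding tip_def by metis+
  then show "G = H" by (simp add: line_def)
  show "a = b"
  proof (rule ccontr)
    assume "a \<noteq> b"
    then have "\<epsilon> * int a < \<epsilon> * int b \<or> \<epsilon> * int b < \<epsilon> * int a"
      using \<epsilon> by (simp add: mult_less_cancel_left) linarith
    then show False
      using f g \<open>G = H\<close> unfolding tip_def by force
  qed
qed

lemma tipI:
  assumes "v (coeff f a) = line G a" "\<And>i. line G i \<le> v (coeff f i)"
    and "\<And>i. v (coeff f i) = line G i \<Longrightarrow> \<epsilon> * int a \<le> \<epsilon> * int i"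
  shows "tip \<epsilon> G f a"
  unfolding tip_def
proof (intro conjI allI impI)
  fix i assume "\<epsilon> * int i < \<epsilon> * int a"
  then have "v (coeff f i) \<noteq> line G i" using assms(3)[of i] by auto
  then show "line G i < v (coeff f i)" using assms(2)[of i] by (simp add: less_le)
qed (rule assms)+

lemma tip_attained_le: "tip \<epsilon> G f a \<Longrightarrow> v (coeff f i) = line G i \<Longrightarrow> \<epsilon> * int a \<le> \<epsilon> * int i"
  unfolding tip_def by (metis less_irrefl not_le)

lemma tip_le: "tip 1 G f a \<Longrightarrow> tip (-1) G f b \<Longrightarrow> a \<le> b"
  using tip_attained_le[of 1 G f a b] by (simp add: tip_def)

text \<open>Equal signs at the two tips mean an even number of sign changes on the line
  (\<open>even_changes_initial_sign_iff\<close>); in this form the property is visibly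
  multiplicative.\<close>

definition balanced :: "'a poly \<Rightarrow> bool" where
  "balanced f \<longleftrightarrow>
     (\<exists>G a b. tip 1 G f a \<and> tip (-1) G f b \<and> sgn (coeff f a) = sgn (coeff f b))"

lemma balanced_mult:
  assumes "balanced f" "balanced g"
  shows "balanced (f * g)"
proof -
  obtain G a b where f: "tip 1 G f a" "tip (-1) G f b" "sgn (coeff f a) = sgn (coeff f b)"
    using assms(1) unfolding balanced_def by blast
  obtain H c d where g: "tip 1 H g c" "tip (-1) H g d" "sgn (coeff g c) = sgn (coeff g d)"
    using assms(2) unfolding balanced_def by blast
  show ?thesis
    unfolding balanced_def
  proof (intro exI conjI)
    show "tip 1 (G + H) (f * g) (a + c)" "tip (-1) (G + H) (f * g) (b + d)"
      using f g by (intro tip_mult; simp)+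
    show "sgn (coeff (f * g) (a + c)) = sgn (coeff (f * g) (b + d))"
      using tip_mult(2)[OF _ f(1) g(1)] tip_mult(2)[OF _ f(2) g(2)] f(3) g(3) by simp
  qed
qed

lemma balanced_const: "c \<noteq> 0 \<Longrightarrow> balanced [:c:]"
proof -
  assume "c \<noteq> 0"
  then obtain r where "v c = ereal r" using v_finite by blast
  then have "tip 1 r [:c:] 0" "tip (-1) r [:c:] 0"
    by (auto simp: tip_def line_def coeff_pCons split: nat.splits)
  then show ?thesis unfolding balanced_def by blast
qed

lemma tip_linear:
  assumes "v \<alpha> = ereal (- \<mu>)"
  shows "tip 1 (- \<mu>) [:- \<alpha>, 1:] 0" "tip (-1) (- \<mu>) [:- \<alpha>, 1:] 1"
  using assms by (auto simp: tip_def line_def coeff_pCons zero_ereal_def algebra_simps split: nat.splits)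

text \<open>A negative root of valuation \<open>- \<mu>\<close> gives the two positive coefficients
  \<open>- \<alpha>\<close> and \<open>1\<close>; for any other valuation the line meets only one
  point.\<close>

lemma balanced_linear:
  assumes "\<not> (v \<alpha> = ereal (- \<mu>) \<and> \<alpha> > 0)"
  shows "balanced [:- \<alpha>, 1:]"
proof -
  consider "v \<alpha> = ereal (- \<mu>)" "\<alpha> \<le> 0" | "v \<alpha> > ereal (- \<mu>)" | "v \<alpha> < ereal (- \<mu>)"
    using assms by (metis linorder_neq_iff not_le)
  then show ?thesis
  proof cases
    case 1
    then have "\<alpha> < 0" using v_ereal_nonzero[OF 1(1)] by simp
    then show ?thesis
      using tip_linear[OF 1(1)] unfolding balanced_def
      by (intro exI[of _ "- \<mu>"] exI[of _ 0] exI[of _ 1]) simp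
  next
    case 2
    then have "tip 1 (- \<mu>) [:- \<alpha>, 1:] 1" "tip (-1) (- \<mu>) [:- \<alpha>, 1:] 1"
      by (auto simp: tip_def line_def coeff_pCons zero_ereal_def algebra_simps split: nat.splits)
    then show ?thesis unfolding balanced_def by blast
  next
    case 3
    then obtain r where "v \<alpha> = ereal r" using v_finite[of \<alpha>] by force
    then have "tip 1 r [:- \<alpha>, 1:] 0" "tip (-1) r [:- \<alpha>, 1:] 0"
      using 3 by (auto simp: tip_def line_def coeff_pCons zero_ereal_def algebra_simps split: nat.splits)
    then show ?thesis unfolding balanced_def by blast
  qed
qed

lemma tip_quadratic:
  shows "v c = ereal G \<Longrightarrow> ereal (G + \<mu>) \<le> v d \<Longrightarrow> G + 2 * \<mu> \<le> 0 \<Longrightarrow> tip 1 G [:c, d, 1:] 0"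
    and "v c = ereal G \<Longrightarrow> ereal (G + \<mu>) < v d \<Longrightarrow> G + 2 * \<mu> < 0 \<Longrightarrow> tip (-1) G [:c, d, 1:] 0"
    and "ereal (- 2 * \<mu>) \<le> v c \<Longrightarrow> ereal (- \<mu>) \<le> v d \<Longrightarrow> tip (-1) (- 2 * \<mu>) [:c, d, 1:] 2"
    and "ereal (- 2 * \<mu>) < v c \<Longrightarrow> ereal (- \<mu>) < v d \<Longrightarrow> tip 1 (- 2 * \<mu>) [:c, d, 1:] 2"
  by (auto simp: tip_def line_def coeff_pCons numeral_2_eq_2 zero_ereal_def less_imp_le
      split: nat.splits)

text \<open>From \<open>a * a \<le> c\<close> one gets \<open>2 v a \<ge> v c\<close>, so the middle
  point lies on or above the segment joining the outer two. Hence the tips belong to the constant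
  and the leading coefficient, both positive.\<close>

lemma balanced_quadratic:
  assumes "b \<noteq> 0"
  shows "balanced [:a * a + b * b, - 2 * a, 1:]"
proof -
  define c where "c = a * a + b * b"
  define d where "d = - 2 * a"
  have pos: "c > 0"
    using assms by (simp add: c_def sum_squares_gt_zero_iff)
  then obtain t where t: "v c = ereal t" using v_finite[of c] by blast
  have "ereal t \<le> v (a * a)"
    unfolding t[symmetric] c_def by (rule v_antimono) simp
  then have "ereal (t / 2) \<le> v a"
    by (cases "v a") (auto simp: v_mult)
  then have "ereal (t / 2) \<le> v (a + a)"
    by (intro v_add_ge)
  moreover have "v d = v (a + a)"
    using v_minus[of "a + a"] by (simp add: d_def)
  ultimately have d: "ereal (t / 2) \<le> v d" by simp
  \<comment> \<open>This compares \<open>\<mu>\<close> with the slope \<open>- t / 2\<close> of the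
    segment from \<open>(0, t)\<close> to \<open>(2, 0)\<close>.\<close>
  consider "t = - 2 * \<mu>" | "t > - 2 * \<mu>" | "t < - 2 * \<mu>" by linarith
  then have "balanced [:c, d, 1:]"
  proof cases
    case 1
    then have "tip 1 t [:c, d, 1:] 0" "tip (-1) t [:c, d, 1:] 2"
      using tip_quadratic(1)[of c t d] tip_quadratic(3)[of c d] t d by auto
    moreover have "sgn (coeff [:c, d, 1:] 0) = sgn (coeff [:c, d, 1:] 2)"
      using pos by (simp add: numeral_2_eq_2)
    ultimately show ?thesis unfolding balanced_def by blast
  next
    case 2
    have "ereal (- \<mu>) < ereal (t / 2)" using 2 by simp
    then have "ereal (- \<mu>) < v d" using d by (rule less_le_trans)
    then have "tip 1 (- 2 * \<mu>) [:c, d, 1:] 2" "tip (-1) (- 2 * \<mu>) [:c, d, 1:] 2"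
      using 2 t by (intro tip_quadratic; simp)+
    then show ?thesis unfolding balanced_def by blast
  next
    case 3
    have "ereal (t + \<mu>) < ereal (t / 2)" using 3 by simp
    then have "ereal (t + \<mu>) < v d" using d by (rule less_le_trans)
    then have "tip 1 t [:c, d, 1:] 0" "tip (-1) t [:c, d, 1:] 0"
      using 3 t by (intro tip_quadratic; simp)+
    then show ?thesis unfolding balanced_def by blast
  qed
  then show ?thesis by (simp only: c_def d_def)
qed

lemma balanced_root_poly:
  assumes "\<And>\<alpha>. \<alpha> \<in> set xs \<Longrightarrow> \<not> (v \<alpha> = ereal (- \<mu>) \<and> \<alpha> > 0)"
  shows "balanced (root_poly xs)"
  using assms
proof (induction xs)
  case Nil
  show ?case using balanced_const[of 1] by (simp add: one_pCons)
next
  case (Cons x xs)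
  then show ?case
    unfolding root_poly_simps by (intro balanced_mult balanced_linear) auto
qed

lemma balanced_no_roots:
  assumes "real_closed TYPE('a)" and "\<forall>x. poly f x \<noteq> 0"
  shows "balanced f"
  using assms(2)
proof (induction "degree f" arbitrary: f rule: less_induct)
  case less
  show ?case
  proof (cases "degree f = 0")
    case True
    then show ?thesis
      using less.prems balanced_const by (metis degree_eq_zeroE pCons_0_0 poly_0)
  next
    case False
    then obtain a b where b: "b \<noteq> 0" and dvd: "[:a * a + b * b, - 2 * a, 1:] dvd f"
      using real_closed_linear_or_quadratic_factor[OF assms(1), of f] less.prems by auto
    then obtain g where g: "f = [:a * a + b * b, - 2 * a, 1:] * g"
      using dvdE[OF dvd] by blast
    have "\<forall>x. poly g x \<noteq> 0"
      using less.prems unfolding g poly_mult by auto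
    moreover from this have "g \<noteq> 0" by auto
    then have "degree g < degree f"
      unfolding g by (subst degree_mult_eq) auto
    ultimately have "balanced g" by (intro less.hyps)
    then show ?thesis
      unfolding g by (intro balanced_mult balanced_quadratic b)
  qed
qed

text \<open>Each factor \<open>X - \<alpha>\<close> has its tips at 0 and 1 with coefficients
  \<open>- \<alpha>\<close> and \<open>1\<close>. So the first tip stays and changes sign if
  \<open>\<alpha> > 0\<close>, while the last one moves up by one and keeps its sign.\<close>

lemma tip_root_poly:
  assumes "\<forall>\<alpha>\<in>set xs. v \<alpha> = ereal (- \<mu>)" and R: "tip 1 G R a" "tip (-1) G R b"
  defines "k \<equiv> length xs"
  shows "tip 1 (G - \<mu> * k) (root_poly xs * R) a" "tip (-1) (G - \<mu> * k) (root_poly xs * R) (b + k)"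
    and "sgn (coeff (root_poly xs * R) (b + k)) = sgn (coeff R b)"
    and "\<forall>\<alpha>\<in>set xs. \<alpha> > 0 \<Longrightarrow>
      sgn (coeff (root_poly xs * R) a) = (-1) ^ k * sgn (coeff R a)"
proof -
  have "tip 1 (G - \<mu> * k) (root_poly xs * R) a \<and> tip (-1) (G - \<mu> * k) (root_poly xs * R) (b + k) \<and>
    sgn (coeff (root_poly xs * R) (b + k)) = sgn (coeff R b) \<and>
    ((\<forall>\<alpha>\<in>set xs. \<alpha> > 0) \<longrightarrow> sgn (coeff (root_poly xs * R) a) = (-1) ^ k * sgn (coeff R a))"
    unfolding k_def using assms(1)
  proof (induction xs)
    case Nil
    then show ?case using R by simp
  next
    case (Cons \<alpha> xs)
    define k where "k = length xs"
    define P where "P = root_poly xs * R"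
    have IH: "tip 1 (G - \<mu> * k) P a" "tip (-1) (G - \<mu> * k) P (b + k)"
      "sgn (coeff P (b + k)) = sgn (coeff R b)"
      "(\<forall>\<alpha>\<in>set xs. \<alpha> > 0) \<longrightarrow> sgn (coeff P a) = (-1) ^ k * sgn (coeff R a)"
      using Cons by (simp_all add: k_def P_def)
    have v\<alpha>: "v \<alpha> = ereal (- \<mu>)" using Cons by simp
    have eq: "root_poly (\<alpha> # xs) * R = [:- \<alpha>, 1:] * P"
      unfolding root_poly_simps P_def by (rule mult.assoc)
    have G: "G - \<mu> * real (length (\<alpha> # xs)) = - \<mu> + (G - \<mu> * k)"
      by (simp add: k_def algebra_simps)
    have b: "b + length (\<alpha> # xs) = 1 + (b + k)" by (simp add: k_def)
    note lo = tip_mult[OF _ tip_linear(1)[OF v\<alpha>] IH(1)]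
    note hi = tip_mult[OF _ tip_linear(2)[OF v\<alpha>] IH(2)]
    show ?case
      unfolding eq G b
      using lo hi IH(3,4) by (simp del: mult_pCons_left add: k_def)
  qed
  then show "tip 1 (G - \<mu> * k) (root_poly xs * R) a" "tip (-1) (G - \<mu> * k) (root_poly xs * R) (b + k)"
    "sgn (coeff (root_poly xs * R) (b + k)) = sgn (coeff R b)"
    "\<forall>\<alpha>\<in>set xs. \<alpha> > 0 \<Longrightarrow>
      sgn (coeff (root_poly xs * R) a) = (-1) ^ k * sgn (coeff R a)"
    by blast+
qed

section \<open>Sign changes along a supporting line\<close>

definition initial_sign :: "real \<Rightarrow> 'a poly \<Rightarrow> nat \<Rightarrow> 'a" where
  "initial_sign G f i = vsgn (line G i) (coeff f i)"

lemma initial_sign_in: "initial_sign G f i \<in> {-1, 0, 1}"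
  unfolding initial_sign_def by (rule vsgn_in)

lemma initial_sign_beyond: "degree f < i \<Longrightarrow> initial_sign G f i = 0"
  by (simp add: initial_sign_def coeff_eq_0 vsgn_def)

lemma initial_sign_tip:
  assumes "tip \<epsilon> G f a"
  shows "initial_sign G f a = sgn (coeff f a)"
    and "\<epsilon> * int i < \<epsilon> * int a \<Longrightarrow> initial_sign G f i = 0"
  using assms by (auto simp: tip_def initial_sign_def vsgn_def)

lemma even_changes_initial_sign_iff:
  assumes "tip 1 G f a" "tip (-1) G f b" "degree f < n"
  shows "even (changes (initial_sign G f) n) \<longleftrightarrow> sgn (coeff f a) = sgn (coeff f b)"
proof -
  have nz: "coeff f a \<noteq> 0" "coeff f b \<noteq> 0"
    using assms tip_nonzero by blast+
  then have "b < n"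
    using assms(3) le_degree[of f b] by simp
  have "even (changes (initial_sign G f) n) \<longleftrightarrow> initial_sign G f a * initial_sign G f b > 0"
    using initial_sign_tip(2)[OF assms(1)] initial_sign_tip(2)[OF assms(2)]
      initial_sign_tip(1)[OF assms(1)] initial_sign_tip(1)[OF assms(2)] nz \<open>b < n\<close>
    by (intro even_changes_iff_ends) (auto simp: sgn_eq_0_iff)
  then show ?thesis
    using initial_sign_tip(1)[OF assms(1)] initial_sign_tip(1)[OF assms(2)] nz
    by (auto simp: sgn_if split: if_splits)
qed

text \<open>Since \<open>v \<alpha> = - \<mu>\<close>, multiplication by \<open>X\<close> and by
  \<open>\<alpha>\<close> both carry the line of intercept \<open>G\<close> to that of intercept
  \<open>G - \<mu>\<close>. The signs therefore meet the assumptions of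
  \<open>changes_descartes_step\<close>.\<close>

lemma changes_initial_sign_linear:
  assumes R: "tip 1 G R a" and \<alpha>: "\<alpha> > 0" "v \<alpha> = ereal (- \<mu>)" and n: "degree R < n"
  shows "changes (initial_sign G R) n + 1
    \<le> changes (initial_sign (G - \<mu>) ([:- \<alpha>, 1:] * R)) (Suc n)"
proof (rule changes_descartes_step[where a = a])
  have ge: "line G i \<le> v (coeff R i)" for i using R by (simp add: tip_def)
  have line_Suc: "line (G - \<mu>) (Suc i) = line G i" for i
    by (simp add: line_def algebra_simps)
  have v_scale: "v (\<alpha> * x) = line (G - \<mu>) i \<longleftrightarrow> v x = line G i"
    and v_scale_le: "line (G - \<mu>) i \<le> v (\<alpha> * x) \<longleftrightarrow> line G i \<le> v x" for x i
    by (cases "v x"; auto simp: v_mult \<alpha>(2) line_def)+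
  have scale: "vsgn (line (G - \<mu>) i) (\<alpha> * x) = vsgn (line G i) x" for x i
    using \<alpha>(1) by (simp add: vsgn_def v_scale sgn_mult)
  show "initial_sign (G - \<mu>) ([:- \<alpha>, 1:] * R) 0 = - initial_sign G R 0"
    by (simp add: initial_sign_def vsgn_minus scale)
  fix i
  assume "initial_sign G R i * initial_sign G R (Suc i) \<le> 0"
  then show "initial_sign (G - \<mu>) ([:- \<alpha>, 1:] * R) (Suc i) =
      sgn (initial_sign G R i - initial_sign G R (Suc i))"
    \<comment> \<open>The real number given here is \<open>line (G - \<mu>) (Suc i)\<close>, and the
      two summands make up the coefficient of \<open>(X - \<alpha>) R\<close> at
      \<open>Suc i\<close>.\<close>
    using vsgn_add[of "G - \<mu> + \<mu> * real (Suc i)" "coeff R i" "- (\<alpha> * coeff R (Suc i))"]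
      ge[of i] ge[of "Suc i"]
    unfolding line_def[symmetric]
    by (simp add: initial_sign_def vsgn_minus scale v_scale_le line_Suc[of i, symmetric]
        del: of_nat_Suc)
next
  show "initial_sign G R a \<noteq> 0"
    using tip_nonzero[OF R] initial_sign_tip(1)[OF R] by (simp add: sgn_eq_0_iff)
next
  show "initial_sign G R i = 0" if "n \<le> i" for i
    using that n by (simp add: initial_sign_beyond)
qed (rule initial_sign_in)+

lemma changes_initial_sign_root_poly:
  assumes "tip 1 G R a" "tip (-1) G R b"
    and "\<forall>\<alpha>\<in>set xs. v \<alpha> = ereal (- \<mu>)" "\<forall>\<alpha>\<in>set xs. \<alpha> > 0"
  shows "length xs \<le> changes (initial_sign (G - \<mu> * length xs) (root_poly xs * R))
    (Suc (degree R) + length xs)"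
  using assms(3,4)
proof (induction xs)
  case (Cons \<alpha> xs)
  define k where "k = length xs"
  define P where "P = root_poly xs * R"
  have R: "R \<noteq> 0" using tip_nonzero[OF assms(1)] by auto
  have eq: "root_poly (\<alpha> # xs) * R = [:- \<alpha>, 1:] * P"
    unfolding root_poly_simps P_def by (rule mult.assoc)
  have G: "G - \<mu> * real (length (\<alpha> # xs)) = G - \<mu> * k - \<mu>"
    by (simp add: k_def algebra_simps)
  have n: "Suc (degree R) + length (\<alpha> # xs) = Suc (Suc (degree R) + k)"
    by (simp add: k_def)
  have "tip 1 (G - \<mu> * k) P a"
    unfolding P_def k_def using Cons.prems assms(1,2) by (intro tip_root_poly(1)) auto
  moreover have "degree P < Suc (degree R) + k"
    using R by (simp add: P_def k_def degree_mult_eq)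
  ultimately have "changes (initial_sign (G - \<mu> * k) P) (Suc (degree R) + k) + 1
    \<le> changes (initial_sign (G - \<mu> * k - \<mu>) ([:- \<alpha>, 1:] * P)) (Suc (Suc (degree R) + k))"
    using Cons.prems by (intro changes_initial_sign_linear) auto
  moreover have "k \<le> changes (initial_sign (G - \<mu> * k) P) (Suc (degree R) + k)"
    unfolding P_def k_def using Cons by auto
  ultimately show ?case
    unfolding eq G n by (simp add: k_def del: mult_pCons_left changes.simps)
qed simp

end

subsection \<open>Edges of the Newton polygon\<close>

context convex_valuation
begin

lemma v_coeff_eq: "coeff f i \<noteq> 0 \<Longrightarrow> v (coeff f i) = ereal (npt v f i)"
  using v_finite[of "coeff f i"] by (auto simp: npt_def)

text \<open>\<open>G\<close> is the intercept of the line through the edge. Exactly the points of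
  the edge attain this line, so extending the sum to all indices only adds zeros.\<close>

lemma newton_edge_imp_tip:
  fixes f a b
  defines "\<mu> \<equiv> newton_slope v f a b" and "G \<equiv> npt v f a - newton_slope v f a b * real a"
  assumes edge: "newton_edge v f a b"
  shows "newton_line.tip v \<mu> 1 G f a" "newton_line.tip v \<mu> (-1) G f b"
    and "edge_poly v f a b = (\<Sum>i\<le>degree f. monom (newton_line.initial_sign v \<mu> G f i) i)"
proof -
  interpret newton_line v \<mu> ..
  have line: "line G i = ereal (npt v f a + \<mu> * (real i - real a))" for i
    unfolding line_def G_def \<mu>_def[symmetric] by (simp add: algebra_simps)
  have ab: "a < b" "coeff f a \<noteq> 0" "coeff f b \<noteq> 0"
    using edge by (simp_all add: newton_edge_def)
  have va: "v (coeff f a) = line G a"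
    using ab by (simp add: line v_coeff_eq)
  have "\<mu> * (real b - real a) = npt v f b - npt v f a"
    using ab by (simp add: \<mu>_def newton_slope_def)
  then have vb: "v (coeff f b) = line G b"
    using ab by (simp add: line v_coeff_eq)
  have ge: "line G i \<le> v (coeff f i)" for i
    using edge le_degree[of f i] unfolding newton_edge_def \<mu>_def[symmetric]
    by (cases "coeff f i = 0") (auto simp: line v_coeff_eq)
  have on_line: "on_line v f a b i \<longleftrightarrow> v (coeff f i) = line G i" for i
    unfolding on_line_def \<mu>_def[symmetric]
    by (cases "coeff f i = 0") (auto simp: line v_coeff_eq)
  have between: "a \<le> i \<and> i \<le> b" if "v (coeff f i) = line G i" for i
  proof -
    have "coeff f i \<noteq> 0" using that by (auto simp: line_def)
    then show ?thesis
      using edge that le_degree[of f i] unfolding newton_edge_def on_line by blast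
  qed
  show "tip 1 G f a" "tip (-1) G f b"
    using va vb ge between by (auto intro!: tipI)
  have on_edge: "on_edge v f a b i \<longleftrightarrow> v (coeff f i) = line G i" for i
    unfolding on_edge_def on_line using between by blast
  show "edge_poly v f a b = (\<Sum>i\<le>degree f. monom (initial_sign G f i) i)"
    unfolding edge_poly_def on_edge
    by (rule sum.mono_neutral_cong_left) (auto simp: initial_sign_def vsgn_def)
qed

text \<open>For (1): once linear factors have separated the tips, these are the ends of an
  edge.\<close>

lemma tip_imp_newton_edge:
  assumes "newton_line.tip v \<mu> 1 G f a" "newton_line.tip v \<mu> (-1) G f b" "a < b"
  shows "newton_edge v f a b" "newton_slope v f a b = \<mu>"
proof -
  interpret newton_line v \<mu> ..
  have nz: "coeff f a \<noteq> 0" "coeff f b \<noteq> 0"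
    using assms tip_nonzero by blast+
  have npt: "npt v f a = G + \<mu> * real a" "npt v f b = G + \<mu> * real b"
    using assms v_coeff_eq[OF nz(1)] v_coeff_eq[OF nz(2)] by (simp_all add: tip_def line_def)
  show slope: "newton_slope v f a b = \<mu>"
    using assms(3) by (simp add: newton_slope_def npt field_simps)
  have ge: "G + \<mu> * real i \<le> npt v f i" if "coeff f i \<noteq> 0" for i
  proof -
    have "line G i \<le> v (coeff f i)" using assms(1) by (simp add: tip_def)
    then show ?thesis by (simp add: v_coeff_eq[OF that] line_def)
  qed
  have on_line: "v (coeff f i) = line G i" if "on_line v f a b i" for i
    using that v_coeff_eq[of f i] by (auto simp: on_line_def slope npt line_def algebra_simps)
  have between: "a \<le> i \<and> i \<le> b" if "on_line v f a b i" for i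
    using tip_attained_le[OF assms(1) on_line[OF that]] tip_attained_le[OF assms(2) on_line[OF that]]
    by simp
  show "newton_edge v f a b"
    unfolding newton_edge_def
    using assms(3) nz le_degree[OF nz(2)] ge between by (auto simp: slope npt algebra_simps)
qed

end

section \<open>Splitting off the roots that belong to an edge\<close>

lemma root_poly_filter:
  "root_poly xs = root_poly (filter p xs) * root_poly (filter (\<lambda>x. \<not> p x) xs)"
  for xs :: "'a::comm_ring_1 list"
  by (induction xs) (simp_all add: mult_ac del: mult_pCons_left mult_pCons_right)

theorem theoremB:
  fixes v :: "'a::linordered_field \<Rightarrow> ereal"
    and P Q :: "'a poly"
    and \<alpha> :: "'a list"
  assumes K_rc: "real_closed TYPE('a)"
    and val: "valuation v"
    and nonarch: "non_archimedean_ordered v"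
    and res_rc: "residue_real_closed v"
    and P_nz: "P \<noteq> 0"
    and fact: "P = smult (lead_coeff P) (Q * (\<Prod>a\<leftarrow>\<alpha>. [:-a, 1:]))"
    and Q_noroot: "\<forall>x. poly Q x \<noteq> 0"
  shows "(\<forall>i < length \<alpha>. \<alpha> ! i \<noteq> 0 \<longrightarrow>
            (\<exists>a b. newton_edge v P a b \<and> v (\<alpha> ! i) = ereal (- newton_slope v P a b)))
       \<and> (\<forall>a b. newton_edge v P a b \<longrightarrow>
            (let m = card {i. i < length \<alpha> \<and> v (\<alpha> ! i) = ereal (- newton_slope v P a b) \<and> \<alpha> ! i > 0}
             in m \<le> sign_changes (edge_poly v P a b) \<and> even (sign_changes (edge_poly v P a b) - m)))"
proof -
  interpret convex_valuation v
    by unfold_locales (fact val nonarch)+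
  define c where "c = lead_coeff P"
  have c: "c \<noteq> 0" using P_nz by (simp add: c_def)
  \<comment> \<open>The predicate stays arbitrary because (1) splits off all roots of valuation
    \<open>- \<mu>\<close>, but (2) only the positive ones.\<close>
  have P_split: "P = root_poly (filter p \<alpha>) * ([:c:] * Q * root_poly (filter (\<lambda>x. \<not> p x) \<alpha>))" for p
  proof -
    have "P = [:c:] * (Q * root_poly \<alpha>)"
      using fact unfolding root_poly_def c_def by simp
    then show ?thesis
      unfolding root_poly_filter[of \<alpha> p] by (simp only: mult_ac)
  qed
  have balanced_rest: "newton_line.balanced v \<mu> ([:c:] * Q * root_poly (filter (\<lambda>x. \<not> p x) \<alpha>))"
    if "\<And>x. v x = ereal (- \<mu>) \<and> x > 0 \<Longrightarrow> p x" for \<mu> p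
  proof -
    interpret newton_line v \<mu> ..
    show ?thesis
      using that by (intro balanced_mult balanced_const c balanced_no_roots K_rc Q_noroot
          balanced_root_poly) auto
  qed
  show ?thesis
  proof (intro conjI allI impI)
    fix i assume i: "i < length \<alpha>" and "\<alpha> ! i \<noteq> 0"
    then obtain r where r: "v (\<alpha> ! i) = ereal r" using v_finite by blast
    define \<mu> where "\<mu> = - r"
    interpret newton_line v \<mu> ..
    define p where "p x \<longleftrightarrow> v x = ereal (- \<mu>)" for x
    define R where "R = [:c:] * Q * root_poly (filter (\<lambda>x. \<not> p x) \<alpha>)"
    define k where "k = length (filter p \<alpha>)"
    have "\<alpha> ! i \<in> set (filter p \<alpha>)"
      using i r by (simp add: p_def \<mu>_def)
    then have "k > 0" unfolding k_def by (metis length_pos_if_in_set)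
    have "balanced R"
      unfolding R_def by (rule balanced_rest) (simp add: p_def)
    then obtain G a b where G: "tip 1 G R a" "tip (-1) G R b"
      unfolding balanced_def by blast
    have tips: "tip 1 (G - \<mu> * k) P a" "tip (-1) (G - \<mu> * k) P (b + k)"
      unfolding P_split[of p] R_def[symmetric] k_def
      using G by (auto intro!: tip_root_poly simp: p_def)
    have "a < b + k"
      using tip_le[OF G] \<open>k > 0\<close> by simp
    then show "\<exists>a b. newton_edge v P a b \<and> v (\<alpha> ! i) = ereal (- newton_slope v P a b)"
      using tip_imp_newton_edge[OF tips] r
      by (intro exI[of _ a] exI[of _ "b + k"]) (simp add: \<mu>_def)
  next
    fix a b assume edge: "newton_edge v P a b"
    define \<mu> where "\<mu> = newton_slope v P a b"
    interpret newton_line v \<mu> ..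
    define G where "G = npt v P a - \<mu> * real a"
    have tips: "tip 1 G P a" "tip (-1) G P b"
      and edge_poly: "edge_poly v P a b = (\<Sum>i\<le>degree P. monom (initial_sign G P i) i)"
      using newton_edge_imp_tip[OF edge] unfolding \<mu>_def G_def by simp_all
    define p where "p x \<longleftrightarrow> v x = ereal (- \<mu>) \<and> x > 0" for x
    define R where "R = [:c:] * Q * root_poly (filter (\<lambda>x. \<not> p x) \<alpha>)"
    define xs where "xs = filter p \<alpha>"
    define n where "n = Suc (degree P)"
    have P: "P = root_poly xs * R"
      unfolding xs_def R_def by (rule P_split)
    have xs: "\<forall>x\<in>set xs. v x = ereal (- \<mu>)" "\<forall>x\<in>set xs. x > 0"
      by (simp_all add: xs_def p_def)
    have "balanced R"
      unfolding R_def by (rule balanced_rest) (simp add: p_def)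
    then obtain H a' b' where H: "tip 1 H R a'" "tip (-1) H R b'"
      and sgn: "sgn (coeff R a') = sgn (coeff R b')"
      unfolding balanced_def by blast
    note rp = tip_root_poly[OF xs(1) H, folded P]
    \<comment> \<open>Supporting lines of equal slope coincide, so the intercept found from the
      factorization is that of the edge.\<close>
    have GH: "H - \<mu> * length xs = G"
      using tip_unique(1)[OF rp(1) tips(1)] by simp
    have R0: "R \<noteq> 0" using P P_nz by auto
    have n_eq: "n = Suc (degree R) + length xs"
      using R0 by (simp add: n_def P degree_mult_eq)
    have coeff_edge: "coeff (edge_poly v P a b) = initial_sign G P"
      using initial_sign_beyond[of P _ G]
      by (auto simp: edge_poly coeff_sum not_le fun_eq_iff)
    have "degree (edge_poly v P a b) < n"
      unfolding n_def less_Suc_eq_le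
      by (rule degree_le) (simp add: coeff_edge initial_sign_beyond)
    then have sc: "sign_changes (edge_poly v P a b) = changes (initial_sign G P) n"
      by (simp add: sign_changes_eq_changes coeff_edge)
    have le: "length xs \<le> changes (initial_sign G P) n"
      using changes_initial_sign_root_poly[OF H xs] unfolding GH n_eq P[symmetric] .
    have "even (changes (initial_sign G P) n) \<longleftrightarrow>
        sgn (coeff P a') = sgn (coeff P (b' + length xs))"
      using rp(1,2) unfolding GH by (rule even_changes_initial_sign_iff) (simp add: n_def)
    \<comment> \<open>The signs of \<open>R\<close> at its tips agree, and the split-off factors
      contribute \<open>(-1) ^ length xs\<close> at the first tip and nothing at the last.\<close>
    also have "\<dots> \<longleftrightarrow> even (length xs)"
      unfolding rp(3) rp(4)[OF xs(2)] sgn using tip_nonzero[OF H(2)]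
      by (cases "even (length xs)") (auto simp: sgn_if)
    finally have parity: "even (changes (initial_sign G P) n) \<longleftrightarrow> even (length xs)" .
    have "card {i. i < length \<alpha> \<and> v (\<alpha> ! i) = ereal (- \<mu>) \<and> \<alpha> ! i > 0} = length xs"
      by (simp add: xs_def p_def length_filter_conv_card)
    then show "let m = card {i. i < length \<alpha> \<and> v (\<alpha> ! i) = ereal (- newton_slope v P a b) \<and> \<alpha> ! i > 0}
        in m \<le> sign_changes (edge_poly v P a b) \<and> even (sign_changes (edge_poly v P a b) - m)"
      unfolding \<mu>_def[symmetric] Let_def sc using le parity by simp
  qed
qed

end
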